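(* Let $n\ge 2$ and let $D\subseteq\{d : d\mid n,\ 1\le d<n\}$ be such that $4\nmid n/d$ for every $d\in D$. Let $\lambda_j=\sum_{d\in D}c(j,n/d)$, $0\le j\le n-1$, be the eigenvalues of $\mathrm{ICG}_n(D)$. Then there exists an odd $j$ with $0\le j\le n-1$ such that $\lambda_j$ is odd if and only if there is a divisor $d\in D$ with $d/2\notin D$ and $2d\notin D$.
   Context: $\mathrm{ICG}_n(D)$ is the graph on $\mathbb{Z}_n=\{0,\dots,n-1\}$ where $a,b$ are adjacent iff $\gcd(a-b,n)\in D$. The Ramanujan function is $c(j,m)=\mu(t_{m,j})\,\varphi(m)/\varphi(t_{m,j})$ with $t_{m,j}=m/\gcd(m,j)$ ($\gcd(m,0)=m$), $\mu$ the Möbius function and $\varphi$ Euler's function. The numbers $\lambda_j$ above are exactly the eigenvalues of the adjacency matrix. The condition $d/2\notin D$ is automatically true when $d$ is odd. *)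

theory Defs
  imports
    "HOL-Computational_Algebra.Squarefree"
    "HOL-Number_Theory.Number_Theory"
    "Graph_Theory.Pair_Digraph"
    "Jordan_Normal_Form.Char_Poly"
begin

definition moebius :: "nat \<Rightarrow> int" where
  "moebius k = (if squarefree k then (-1) ^ card (prime_factors k) else 0)"

text \<open>
  The division is exact since \<open>m div gcd m j\<close> divides \<open>m\<close>, see \<open>of_int_ramanujan_c\<close> below.
\<close>

definition ramanujan_c :: "nat \<Rightarrow> nat \<Rightarrow> int" where
  "ramanujan_c j m =
     (let t = m div gcd m j in moebius t * int (totient m) div int (totient t))"

text \<open>The difference is taken in the integers, since subtraction truncates on \<open>nat\<close>.\<close>

definition icg :: "nat \<Rightarrow> nat set \<Rightarrow> nat pair_pre_digraph" where
  "icg n D = \<lparr> pverts = {0..<n},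
     parcs = {(a, b). a < n \<and> b < n \<and> nat (gcd (int a - int b) (int n)) \<in> D} \<rparr>"

definition icg_adj_mat :: "nat \<Rightarrow> nat set \<Rightarrow> complex mat" where
  "icg_adj_mat n D = mat n n (\<lambda>(a, b). if (a, b) \<in> parcs (icg n D) then 1 else 0)"

definition icg_eigenvalue :: "nat \<Rightarrow> nat set \<Rightarrow> nat \<Rightarrow> int" where
  "icg_eigenvalue n D j = (\<Sum>d\<in>D. ramanujan_c j (n div d))"


lemma of_int_ramanujan_c:
  fixes j m :: nat
  assumes "m > 0"
  defines "t \<equiv> m div gcd m j"
  shows "real_of_int (ramanujan_c j m) =
           of_int (moebius t) * of_nat (totient m) / of_nat (totient t)"
proof -
  have "t dvd m" unfolding t_def by (metis div_dvd_iff_mult dvd_triv_left gcd_dvd1 assms(1) gcd_pos_nat less_not_refl2)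
  hence "totient t dvd totient m" by (rule totient_dvd)
  hence "int (totient t) dvd moebius t * int (totient m)"
    by simp
  thus ?thesis
    by (simp add: ramanujan_c_def t_def[symmetric] Let_def real_of_int_div)
qed

subsection \<open>The numbers \<open>icg_eigenvalue n D j\<close> are the eigenvalues of the adjacency matrix\<close>

definition unit_root :: "nat \<Rightarrow> nat \<Rightarrow> complex" where
  "unit_root t k = cis (2 * pi * real k / real t)"

lemma unit_root_0 [simp]: "unit_root t 0 = 1"
  by (simp add: unit_root_def)

lemma unit_root_add: "unit_root t (a + b) = unit_root t a * unit_root t b"
  by (simp add: unit_root_def cis_mult add_divide_distrib distrib_left)

lemma unit_root_power: "unit_root t a ^ k = unit_root t (a * k)"
  by (simp add: unit_root_def DeMoivre mult_ac)

lemma unit_root_scale: "d > 0 \<Longrightarrow> unit_root (t * d) (k * d) = unit_root t k"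
  by (simp add: unit_root_def mult.assoc)

lemma unit_root_self [simp]: "t > 0 \<Longrightarrow> unit_root t t = 1"
  by (simp add: unit_root_def)

lemma unit_root_mult_self: "t > 0 \<Longrightarrow> unit_root t (t * k) = 1"
  using unit_root_power[of t t k] by simp

lemma unit_root_mod: "t > 0 \<Longrightarrow> unit_root t (k mod t) = unit_root t k"
proof -
  assume t: "t > 0"
  have "unit_root t k = unit_root t (t * (k div t) + k mod t)" by simp
  also have "\<dots> = unit_root t (k mod t)"
    using t by (simp only: unit_root_add unit_root_mult_self mult_1_left)
  finally show ?thesis by simp
qed

lemma unit_root_cong: "t > 0 \<Longrightarrow> [a = b] (mod t) \<Longrightarrow> unit_root t a = unit_root t b"
  by (metis unit_root_mod cong_def)

lemma unit_root_eq_1_iff: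
  assumes "t > 0"
  shows "unit_root t k = 1 \<longleftrightarrow> t dvd k"
proof
  assume "unit_root t k = 1"
  hence "unit_root t (k mod t) = 1" using assms by (simp add: unit_root_mod)
  hence "cos (2 * pi * real (k mod t) / real t) = 1"
    by (simp add: unit_root_def complex_eq_iff)
  then obtain i :: int where "2 * pi * real (k mod t) / real t = of_int i * 2 * pi"
    using cos_one_2pi_int by auto
  hence "real (k mod t) = of_int i * real t" using assms by (simp add: field_simps)
  hence "int (k mod t) = i * int t"
    by (metis of_int_eq_iff of_int_mult of_int_of_nat_eq)
  moreover have "k mod t < t" using assms by simp
  ultimately have "k mod t = 0"
    by (metis dvd_imp_le dvd_triv_right gr0I int_dvd_int_iff leD)
  thus "t dvd k" by auto
next
  assume "t dvd k"
  thus "unit_root t k = 1" using assms by (auto simp: unit_root_mult_self)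
qed

lemma sum_unit_root:
  assumes "t > 0"
  shows "(\<Sum>k<t. unit_root t (a * k)) = (if t dvd a then of_nat t else 0)"
proof (cases "t dvd a")
  case True
  have "unit_root t (a * k) = 1" for k using True assms by (simp add: unit_root_eq_1_iff)
  thus ?thesis using True by simp
next
  case False
  let ?z = "unit_root t a"
  have "?z \<noteq> 1" using False assms by (simp add: unit_root_eq_1_iff)
  moreover have "?z ^ t = 1" using assms by (simp add: unit_root_power unit_root_eq_1_iff)
  ultimately have "(\<Sum>k<t. ?z ^ k) = 0" by (simp add: geometric_sum)
  thus ?thesis using False by (simp add: unit_root_power)
qed

lemma sum_unit_root_pos:
  assumes "t > 0"
  shows "(\<Sum>k\<in>{0<..t}. unit_root t k) = (if t = 1 then 1 else 0)"
proof -
  have "{0<..t} = insert t {1..<t}" and "{..<t} = insert 0 {1..<t}" using assms by auto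
  hence "(\<Sum>k\<in>{0<..t}. unit_root t k) = (\<Sum>k<t. unit_root t (1 * k))"
    using assms by simp
  also have "\<dots> = (if t = 1 then 1 else 0)"
    using assms by (subst sum_unit_root) auto
  finally show ?thesis .
qed

lemma sum_gcd_eq:
  assumes "d dvd n" "n > 0"
  shows "(\<Sum>k | k \<in> {0<..n} \<and> gcd k n = d. unit_root n (j * k)) =
         (\<Sum>k\<in>totatives (n div d). unit_root (n div d) (j * k))"
proof -
  obtain e where n: "n = e * d" using assms by (metis dvd_div_mult_self)
  have d: "d > 0" using n assms by auto
  have "(\<Sum>k | k \<in> {0<..n} \<and> gcd k n = d. unit_root n (j * k)) =
        (\<Sum>k\<in>totatives (n div d). unit_root n (j * (k * d)))"
    by (rule sum.reindex_bij_betw[OF bij_betw_totatives_gcd_eq[OF assms], symmetric])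
  also have "\<dots> = (\<Sum>k\<in>totatives (n div d). unit_root (n div d) (j * k))"
  proof (rule sum.cong)
    fix k
    have "unit_root n (j * (k * d)) = unit_root (e * d) (j * k * d)" using n by (simp add: mult_ac)
    also have "\<dots> = unit_root (n div d) (j * k)" using unit_root_scale[OF d] n d by simp
    finally show "unit_root n (j * (k * d)) = unit_root (n div d) (j * k)" .
  qed simp
  finally show ?thesis .
qed

lemma sum_divisors_totatives:
  assumes "n > 0"
  shows "(\<Sum>d | d dvd n. \<Sum>k\<in>totatives d. unit_root d k) = (if n = 1 then 1 else 0)"
proof -
  have fin: "finite {d. d dvd n}" using assms by simp
  have inv: "n div d dvd n" "n div (n div d) = d" if "d dvd n" for d
    using that assms by auto
  have "(\<Sum>d | d dvd n. \<Sum>k\<in>totatives d. unit_root d k) =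
        (\<Sum>d | d dvd n. \<Sum>k\<in>totatives (n div d). unit_root (n div d) k)"
    by (rule sum.reindex_bij_witness[of _ "\<lambda>d. n div d" "\<lambda>d. n div d"]) (simp_all add: inv)
  also have "\<dots> = (\<Sum>d | d dvd n. \<Sum>k | k \<in> {0<..n} \<and> gcd k n = d. unit_root n k)"
    by (rule sum.cong) (use sum_gcd_eq[of _ n 1] assms in auto)
  also have "\<dots> = (\<Sum>k\<in>{0<..n}. unit_root n k)"
    using sum.group[of "{0<..n}" "{d. d dvd n}" "\<lambda>k. gcd k n" "unit_root n"] fin
    by (auto simp: image_subset_iff)
  finally show ?thesis using sum_unit_root_pos[OF assms] by simp
qed

lemma moebius_1 [simp]: "moebius (Suc 0) = 1"
  by (simp add: moebius_def)

lemma moebius_prime_mult: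
  assumes p: "prime p" and nd: "\<not> p dvd d" and d: "d > 0"
  shows "moebius (p * d) = - moebius d"
proof -
  have cop: "coprime p d" using p nd by (rule prime_imp_coprime)
  have sq: "squarefree (p * d) \<longleftrightarrow> squarefree d"
    using p cop by (auto simp: squarefree_mult_coprime squarefree_prime dest: squarefree_multD)
  have "prime_factors (p * d) = insert p (prime_factors d)"
    using p d by (simp add: prime_factors_product prime_prime_factors)
  moreover have "p \<notin> prime_factors d" using nd by auto
  ultimately show ?thesis by (simp add: moebius_def sq)
qed

lemma moebius_not_squarefree: "\<not> squarefree d \<Longrightarrow> moebius d = 0"
  by (simp add: moebius_def)

lemma sum_moebius:
  assumes "n > 0"
  shows "(\<Sum>d | d dvd n. moebius d) = (if n = 1 then 1 else 0)"
proof (cases "n = 1")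
  case False
  then obtain p where p: "prime p" "p dvd n" using prime_factor_nat by blast
  let ?A = "{d. d dvd n \<and> squarefree d \<and> \<not> p dvd d}"
  let ?B = "{d. d dvd n \<and> squarefree d \<and> p dvd d}"
  have fin: "finite {d. d dvd n}" using assms by simp
  have "(\<Sum>d | d dvd n. moebius d) = (\<Sum>d\<in>?A \<union> ?B. moebius d)"
    by (rule sum.mono_neutral_right) (use fin moebius_not_squarefree in auto)
  also have "\<dots> = sum moebius ?A + sum moebius ?B"
    by (rule sum.union_disjoint) (use fin in auto)
  also have "sum moebius ?B = (\<Sum>d\<in>?A. moebius (p * d))"
  proof (rule sum.reindex_bij_witness[of _ "\<lambda>d. p * d" "\<lambda>d. d div p"])
    fix d assume d: "d \<in> ?B"
    show "p * (d div p) = d" using d by simp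
    show "d div p \<in> ?A"
    proof -
      have "d div p dvd d" using d by (metis dvd_mult_div_cancel dvd_triv_right mem_Collect_eq)
      moreover have "\<not> p dvd d div p"
      proof
        assume "p dvd d div p"
        hence "p ^ 2 dvd d" using d by (metis (no_types, lifting) dvd_mult_div_cancel mem_Collect_eq
              mult_dvd_mono dvd_refl power2_eq_square)
        thus False using d p by (metis (no_types, lifting) mem_Collect_eq squarefreeD not_prime_unit)
      qed
      ultimately show ?thesis using d by (auto intro: dvd_trans squarefree_mono)
    qed
    show "moebius (p * (d div p)) = moebius d" using d by simp
  next
    fix d assume d: "d \<in> ?A"
    show "p * d div p = d" using p by (simp add: prime_gt_0_nat)
    have cop: "coprime p d" using p d by (auto intro: prime_imp_coprime)
    show "p * d \<in> ?B" using d p cop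
      by (auto intro: divides_mult simp: squarefree_mult_coprime squarefree_prime)
  qed
  also have "\<dots> = - sum moebius ?A"
    unfolding sum_negf[symmetric]
  proof (rule sum.cong)
    fix d assume "d \<in> ?A"
    thus "moebius (p * d) = - moebius d" using p assms
      by (intro moebius_prime_mult) (auto intro: Nat.gr0I)
  qed simp
  finally show ?thesis using False by simp
qed simp

lemma sum_totatives_unit_root:
  assumes "n > 0"
  shows "(\<Sum>k\<in>totatives n. unit_root n k) = of_int (moebius n)"
  using assms
proof (induction n rule: less_induct)
  case (less n)
  let ?S = "\<lambda>d. \<Sum>k\<in>totatives d. unit_root d k"
  have fin: "finite {d. d dvd n}" using less by simp
  have 1: "(\<Sum>d | d dvd n. ?S d) = ?S n + (\<Sum>d\<in>{d. d dvd n} - {n}. ?S d)"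
    by (rule sum.remove) (use fin in auto)
  have 2: "(\<Sum>d | d dvd n. complex_of_int (moebius d)) =
      of_int (moebius n) + (\<Sum>d\<in>{d. d dvd n} - {n}. of_int (moebius d))"
    by (rule sum.remove) (use fin in auto)
  have 3: "(\<Sum>d\<in>{d. d dvd n} - {n}. ?S d) = (\<Sum>d\<in>{d. d dvd n} - {n}. of_int (moebius d))"
  proof (rule sum.cong)
    fix d assume d: "d \<in> {d. d dvd n} - {n}"
    hence "d \<le> n" "d \<noteq> n" "d > 0" using less.prems by (auto intro: dvd_imp_le Nat.gr0I)
    thus "?S d = of_int (moebius d)" by (intro less.IH) auto
  qed simp
  have "(\<Sum>d | d dvd n. complex_of_int (moebius d)) = (if n = 1 then 1 else 0)"
    using arg_cong[OF sum_moebius[OF less.prems], of complex_of_int] by simp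
  thus ?case using 1 2 3 sum_divisors_totatives[OF less.prems] by simp
qed

lemma sum_totatives_mult:
  fixes f :: "nat \<Rightarrow> complex"
  assumes m: "m > 0" and u: "coprime u m"
    and f: "\<And>a b. [a = b] (mod m) \<Longrightarrow> f a = f b"
  shows "(\<Sum>k\<in>totatives m. f (u * k)) = (\<Sum>k\<in>totatives m. f k)"
proof (cases "m = 1")
  case True
  thus ?thesis using f by (auto intro!: f)
next
  case False
  hence m1: "m > 1" using m by simp
  let ?h = "\<lambda>k. (u * k) mod m"
  have sub: "?h ` totatives m \<subseteq> totatives m"
  proof safe
    fix k assume k: "k \<in> totatives m"
    hence "coprime (u * k) m" using u by (simp add: in_totatives_iff)
    hence c: "coprime (?h k) m" using m by simp
    moreover have "?h k \<noteq> 0"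
    proof
      assume "?h k = 0"
      with c show False using m1 by simp
    qed
    moreover have "?h k < m" using m by simp
    ultimately show "?h k \<in> totatives m" by (simp add: in_totatives_iff)
  qed
  have inj: "inj_on ?h (totatives m)"
  proof (rule inj_onI)
    fix a b assume ab: "a \<in> totatives m" "b \<in> totatives m" "?h a = ?h b"
    hence "[u * a = u * b] (mod m)" by (simp add: cong_def)
    hence "[a = b] (mod m)" using u by (simp add: cong_mult_lcancel_nat)
    thus "a = b" using ab m1 totatives_less[of a m] totatives_less[of b m] by (simp add: cong_def)
  qed
  have surj: "?h ` totatives m = totatives m"
    by (rule endo_inj_surj[OF finite_totatives sub inj])
  have "(\<Sum>k\<in>totatives m. f k) = (\<Sum>k\<in>?h ` totatives m. f k)" by (simp only: surj)
  also have "\<dots> = (\<Sum>k\<in>totatives m. f (?h k))"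
    using sum.reindex[OF inj, of f] by (simp add: o_def)
  also have "\<dots> = (\<Sum>k\<in>totatives m. f (u * k))"
    by (rule sum.cong) (auto intro!: f simp: cong_def)
  finally show ?thesis by simp
qed

lemma coprime_lift:
  fixes r t m :: nat
  assumes r: "coprime r t" and t: "t dvd m" and m: "m > 0"
  obtains u where "coprime u m" "[u = r] (mod t)"
proof -
  define Q where "Q = {p \<in> prime_factors m. \<not> p dvd t \<and> \<not> p dvd r}"
  have finQ: "finite Q" unfolding Q_def by simp
  define u where "u = r + t * \<Prod>Q"
  have "\<not> p dvd u" if p: "prime p" "p dvd m" for p
  proof
    assume pu: "p dvd u"
    have dq: "p dvd \<Prod>Q \<longleftrightarrow> p \<in> Q"
    proof
      assume "p dvd \<Prod>Q"
      then obtain q where q: "q \<in> Q" "p dvd q"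
        using prime_dvd_prod_iff[OF finQ p(1), of "\<lambda>x. x"] by auto
      hence "p = q" using p by (intro primes_dvd_imp_eq) (auto simp: Q_def)
      thus "p \<in> Q" using q by simp
    next
      assume "p \<in> Q"
      thus "p dvd \<Prod>Q" using finQ dvd_prodI[of Q p "\<lambda>x. x"] by simp
    qed
    have nrt: "\<not> (p dvd r \<and> p dvd t)"
      using r p(1) by (metis coprime_common_divisor not_prime_unit)
    have pm: "p \<in> prime_factors m" using p m by (simp add: prime_factors_dvd)
    show False
    proof (cases "p dvd t \<or> p \<in> Q")
      case True
      hence "p dvd t * \<Prod>Q" using dq by auto
      hence "p dvd r" using pu by (simp add: u_def dvd_add_left_iff)
      thus False using True nrt by (auto simp: Q_def)
    next
      case False
      hence pr: "p dvd r" using pm by (auto simp: Q_def)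
      hence "p dvd t * \<Prod>Q" using pu by (simp add: u_def dvd_add_right_iff)
      hence "p dvd t \<or> p dvd \<Prod>Q" using p by (simp add: prime_dvd_mult_iff)
      thus False using False dq by simp
    qed
  qed
  hence "coprime u m"
    using m by (metis coprime_iff_gcd_eq_1 gcd_dvd1 gcd_dvd2 dvd_trans prime_factor_nat)
  moreover have "[u = r] (mod t)" by (simp add: u_def cong_def)
  ultimately show ?thesis using that by blast
qed

lemma ramanujan_sum:
  assumes m: "m > 0"
  shows "(\<Sum>k\<in>totatives m. unit_root m (j * k)) = of_int (ramanujan_c j m)"
proof -
  define g where "g = gcd m j"
  define t where "t = m div g"
  define j' where "j' = j div g"
  have g: "g > 0" using m by (simp add: g_def)
  have mg: "m = t * g" and jg: "j = j' * g" by (simp_all add: t_def j'_def g_def)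
  have t: "t > 0" "t dvd m" using mg m by auto
  have cop: "coprime j' t" unfolding t_def j'_def g_def
    using m by (metis coprime_commute div_gcd_coprime less_not_refl2)
  define T where "T = (\<Sum>k\<in>totatives m. unit_root t k)"
  have T: "(\<Sum>k\<in>totatives m. unit_root t (r * k)) = T" if r: "coprime r t" for r
  proof -
    obtain u where u: "coprime u m" "[u = r] (mod t)" using coprime_lift[OF r t(2) m] .
    have "(\<Sum>k\<in>totatives m. unit_root t (r * k)) = (\<Sum>k\<in>totatives m. unit_root t (u * k))"
      by (rule sum.cong)
         (auto intro!: unit_root_cong t cong_mult cong_sym[OF u(2)])
    also have "\<dots> = T" unfolding T_def
      by (rule sum_totatives_mult[OF m u(1)])
         (auto intro: unit_root_cong[OF t(1)] cong_dvd_modulus_nat t)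
    finally show ?thesis .
  qed
  have "of_nat (totient t) * T = (\<Sum>r\<in>totatives t. T)" by (simp add: totient_def)
  also have "\<dots> = (\<Sum>r\<in>totatives t. \<Sum>k\<in>totatives m. unit_root t (r * k))"
    by (rule sum.cong) (auto simp: T in_totatives_iff)
  also have "\<dots> = (\<Sum>k\<in>totatives m. \<Sum>r\<in>totatives t. unit_root t (k * r))"
    by (subst sum.swap) (simp add: mult.commute)
  also have "\<dots> = (\<Sum>k\<in>totatives m. of_int (moebius t))"
  proof (rule sum.cong)
    fix k assume "k \<in> totatives m"
    hence "coprime k m" by (simp add: in_totatives_iff)
    hence "coprime k t" using coprime_divisors[OF dvd_refl t(2)] by blast
    hence "(\<Sum>r\<in>totatives t. unit_root t (k * r)) = (\<Sum>r\<in>totatives t. unit_root t r)"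
      by (intro sum_totatives_mult t) (auto intro: unit_root_cong t)
    thus "(\<Sum>r\<in>totatives t. unit_root t (k * r)) = of_int (moebius t)"
      using sum_totatives_unit_root[OF t(1)] by simp
  qed simp
  also have "\<dots> = of_nat (totient m) * of_int (moebius t)" by (simp add: totient_def)
  finally have *: "of_nat (totient t) * T = of_nat (totient m) * of_int (moebius t)" .
  obtain q where q: "totient m = totient t * q" using totient_dvd[OF t(2)] by auto
  have tt: "totient t > 0" using t by simp
  have "T = of_nat q * of_int (moebius t)" using * q tt by simp
  moreover have "ramanujan_c j m = int q * moebius t"
    using q tt by (simp add: ramanujan_c_def Let_def g_def[symmetric] t_def[symmetric] mult_ac)
  moreover have "unit_root m (j * k) = unit_root t (j' * k)" for k
    using unit_root_scale[OF g, of t "j' * k"] mg jg by (simp add: mult_ac)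
  ultimately show ?thesis using T[OF cop] by simp
qed

lemma icg_row_sum:
  assumes n: "n > 0" and D: "D \<subseteq> {d. d dvd n \<and> d < n}" and a: "a < n"
  shows "(\<Sum>b<n. (if (a, b) \<in> parcs (icg n D) then 1 else 0) * unit_root n (j * b)) =
         unit_root n (j * a) * of_int (icg_eigenvalue n D j)"
proof -
  have finD: "finite D" by (rule finite_subset[OF D]) (use n in auto)
  have gcd_eq: "nat (gcd (int a - int ((a + k) mod n)) (int n)) = gcd k n" for k
  proof -
    have "[int a - int ((a + k) mod n) = - int k] (mod int n)"
      by (simp add: cong_def zmod_int mod_diff_right_eq)
    hence "gcd (int a - int ((a + k) mod n)) (int n) = gcd (- int k) (int n)"
      by (rule cong_gcd_eq)
    thus ?thesis by simp
  qed
  have inj: "inj_on (\<lambda>k. (a + k) mod n) {..<n}"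
  proof (rule inj_onI)
    fix x y assume xy: "x \<in> {..<n}" "y \<in> {..<n}" "(a + x) mod n = (a + y) mod n"
    hence "[a + x = a + y] (mod n)" by (simp add: cong_def)
    hence "[x = y] (mod n)" by (simp add: cong_add_lcancel_nat)
    thus "x = y" using xy by (simp add: cong_def)
  qed
  have surj: "(\<lambda>k. (a + k) mod n) ` {..<n} = {..<n}"
    by (rule endo_inj_surj[OF _ _ inj]) (use n in auto)
  let ?f = "\<lambda>b. (if (a, b) \<in> parcs (icg n D) then 1 else 0) * unit_root n (j * b)"
  have "(\<Sum>b<n. ?f b) = (\<Sum>k<n. ?f ((a + k) mod n))"
    using sum.reindex[OF inj, of ?f] by (simp add: surj o_def)
  also have "\<dots> = (\<Sum>k<n. (if gcd k n \<in> D then unit_root n (j * a) * unit_root n (j * k) else 0))"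
  proof (rule sum.cong)
    fix k assume k: "k \<in> {..<n}"
    have "unit_root n (j * ((a + k) mod n)) = unit_root n (j * (a + k))"
      by (rule unit_root_cong[OF n]) (simp add: cong_def mod_mult_right_eq)
    thus "?f ((a + k) mod n) =
        (if gcd k n \<in> D then unit_root n (j * a) * unit_root n (j * k) else 0)"
      using a n by (simp add: icg_def gcd_eq unit_root_add distrib_left)
  qed simp
  also have "\<dots> = unit_root n (j * a) * (\<Sum>k<n. if gcd k n \<in> D then unit_root n (j * k) else 0)"
    by (simp add: sum_distrib_left if_distrib cong: if_cong)
  also have "(\<Sum>k<n. if gcd k n \<in> D then unit_root n (j * k) else 0) =
      (\<Sum>k\<in>{0<..n}. if gcd k n \<in> D then unit_root n (j * k) else 0)"
    by (rule sum.mono_neutral_cong) (use D in \<open>auto simp: le_less\<close>)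
  also have "\<dots> = (\<Sum>k | k \<in> {0<..n} \<and> gcd k n \<in> D. unit_root n (j * k))"
    by (simp add: sum.If_cases Int_def)
  also have "\<dots> = (\<Sum>d\<in>D. \<Sum>k | k \<in> {0<..n} \<and> gcd k n = d. unit_root n (j * k))"
  proof -
    have "(\<Sum>d\<in>D. \<Sum>k | k \<in> {k \<in> {0<..n}. gcd k n \<in> D} \<and> gcd k n = d. unit_root n (j * k)) =
        (\<Sum>k | k \<in> {0<..n} \<and> gcd k n \<in> D. unit_root n (j * k))"
      by (rule sum.group) (use finD in auto)
    moreover have "{k. k \<in> {k \<in> {0<..n}. gcd k n \<in> D} \<and> gcd k n = d} =
        {k. k \<in> {0<..n} \<and> gcd k n = d}" if "d \<in> D" for d using that by auto
    ultimately show ?thesis by simp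
  qed
  also have "\<dots> = (\<Sum>d\<in>D. of_int (ramanujan_c j (n div d)))"
  proof (rule sum.cong)
    fix d assume "d \<in> D"
    hence d: "d dvd n" using D by auto
    hence d': "n div d > 0" using n by (simp add: div_greater_zero_iff dvd_imp_le dvd_pos_nat)
    show "(\<Sum>k | k \<in> {0<..n} \<and> gcd k n = d. unit_root n (j * k)) = of_int (ramanujan_c j (n div d))"
      using sum_gcd_eq[OF d n] ramanujan_sum[OF d'] by simp
  qed simp
  finally show ?thesis by (simp add: icg_eigenvalue_def)
qed

theorem char_poly_icg_adj_mat:
  assumes n: "n > 0" and D: "D \<subseteq> {d. d dvd n \<and> d < n}"
  shows "char_poly (icg_adj_mat n D) = (\<Prod>j<n. [: - of_int (icg_eigenvalue n D j), 1 :])"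
proof -
  define F where "F = mat n n (\<lambda>(a, j). unit_root n (j * a))"
  define G where "G = mat n n (\<lambda>(j, b). unit_root n (j * (n - b)) / of_nat n)"
  define L where "L = mat n n (\<lambda>(i, j). if i = j then complex_of_int (icg_eigenvalue n D j) else 0)"
  have carr: "F \<in> carrier_mat n n" "G \<in> carrier_mat n n" "L \<in> carrier_mat n n"
    "icg_adj_mat n D \<in> carrier_mat n n"
    by (simp_all add: F_def G_def L_def icg_adj_mat_def)
  have dvd_iff: "n dvd a + (n - b) \<longleftrightarrow> a = b" if "a < n" "b < n" for a b
  proof
    assume "n dvd a + (n - b)"
    then obtain q where q: "a + (n - b) = n * q" by auto
    have "n * q < n * 2" "n * q > 0" using q that by linarith+
    hence "q < 2" "q > 0" by auto
    hence "q = 1" by linarith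
    thus "a = b" using q that by simp
  qed (use that in auto)
  have FG: "F * G = 1\<^sub>m n"
  proof (rule eq_matI)
    fix a b assume ab: "a < dim_row (1\<^sub>m n)" "b < dim_col (1\<^sub>m n)"
    have "(F * G) $$ (a, b) = (\<Sum>j<n. unit_root n ((a + (n - b)) * j)) / of_nat n"
      using ab by (simp add: F_def G_def scalar_prod_def unit_root_add[symmetric]
          sum_divide_distrib atLeast0LessThan algebra_simps)
    thus "(F * G) $$ (a, b) = 1\<^sub>m n $$ (a, b)"
      using ab n dvd_iff[of a b] by (simp add: sum_unit_root)
  qed (use carr in auto)
  have GF: "G * F = 1\<^sub>m n" by (rule mat_mult_left_right_inverse[OF carr(1,2) FG])
  have AF: "icg_adj_mat n D * F = F * L"
  proof (rule eq_matI)
    fix a j assume aj: "a < dim_row (F * L)" "j < dim_col (F * L)"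
    hence aj: "a < n" "j < n" using carr by auto
    have "(icg_adj_mat n D * F) $$ (a, j) = unit_root n (j * a) * of_int (icg_eigenvalue n D j)"
      using aj icg_row_sum[OF n D aj(1), of j]
      by (simp add: F_def icg_adj_mat_def scalar_prod_def atLeast0LessThan)
    also have "\<dots> = (F * L) $$ (a, j)"
      using aj by (simp add: F_def L_def scalar_prod_def atLeast0LessThan if_distrib
          cong: if_cong)
    finally show "(icg_adj_mat n D * F) $$ (a, j) = (F * L) $$ (a, j)" .
  qed (use carr in auto)
  have "icg_adj_mat n D = icg_adj_mat n D * (F * G)" using carr by (simp add: FG)
  also have "\<dots> = icg_adj_mat n D * F * G"
    by (rule assoc_mult_mat[symmetric]) (rule carr)+
  also have "\<dots> = F * L * G" by (simp only: AF)
  finally have "similar_mat (icg_adj_mat n D) L"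
    by (intro similar_matI[of _ _ F G n] FG GF) (use carr in auto)
  hence "char_poly (icg_adj_mat n D) = char_poly L" by (rule char_poly_similar)
  also have "\<dots> = (\<Prod>a \<leftarrow> diag_mat L. [:- a, 1:])"
    by (rule char_poly_upper_triangular[OF carr(3)]) (auto simp: upper_triangular_def L_def)
  also have "\<dots> = (\<Prod>j<n. [: - of_int (icg_eigenvalue n D j), 1 :])"
    by (simp add: diag_mat_def L_def prod.list_conv_set_nth atLeast0LessThan)
  finally show ?thesis .
qed

end

theory Submission
  imports Defs
begin

text \<open>
  For odd \<open>j\<close> and \<open>k\<close> one has \<open>c(j, 2k) = - c(j, k)\<close>, so the terms of \<open>d\<close> and \<open>2d\<close> cancel whenever
  both lie in \<open>D\<close>, and the eigenvalue is the sum over the unpaired divisors only. Conversely, let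
  \<open>m\<close> be minimal among the odd parts of \<open>n/d\<close> for unpaired \<open>d\<close>, let \<open>N\<close> be the part of \<open>n\<close> coprime
  to \<open>2m\<close>, and put \<open>j = m N / rad m\<close>. Then \<open>c(j, m)\<close> is odd, whereas for odd \<open>m'\<close> dividing \<open>n\<close>
  oddness of \<open>c(j, m')\<close> forces \<open>m'\<close> to divide \<open>m\<close>; by minimality exactly one term is odd.
\<close>

section \<open>Parity and doubling of Ramanujan sums\<close>

lemma ramanujan_c_eq:
  fixes m j :: nat
  assumes "m > 0" and "t = m div gcd m j" and "totient m = totient t * q"
  shows "ramanujan_c j m = moebius t * int q"
proof -
  have "t > 0" using assms by (simp add: div_greater_zero_iff dvd_imp_le)
  thus ?thesis using assms(3) by (simp add: ramanujan_c_def Let_def assms(2)[symmetric])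
qed

lemma odd_moebius_iff: "odd (moebius t) \<longleftrightarrow> squarefree t"
  by (simp add: moebius_def)

text \<open>An odd \<open>j\<close> does not see the factor 2 in the gcd, so doubling
  \<open>k\<close> doubles \<open>t\<close>: both totients stay the same, while the new prime 2
  flips the sign of \<open>moebius t\<close>.\<close>

lemma ramanujan_c_double:
  assumes j: "odd j" and k: "odd k"
  shows "ramanujan_c j (2 * k) = - ramanujan_c j k"
proof -
  define t where "t = k div gcd k j"
  have k0: "k > 0" using k by (simp add: odd_pos)
  have g: "gcd (2 * k) j = gcd k j"
    using j by (simp add: gcd_mult_left_left_cancel odd_imp_coprime_nat coprime_commute)
  have kt: "k = t * gcd k j" by (simp add: t_def)
  hence t: "odd t" "t > 0" using k k0 by (metis even_mult_iff, metis gr0I mult_0)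
  have "t dvd k" using kt by (metis dvd_triv_left)
  then obtain q where q: "totient k = totient t * q" using totient_dvd by blast
  have "ramanujan_c j k = moebius t * int q"
    by (rule ramanujan_c_eq[OF k0 t_def q])
  moreover have "ramanujan_c j (2 * k) = moebius (2 * t) * int q"
  proof (rule ramanujan_c_eq)
    show "2 * t = 2 * k div gcd (2 * k) j" unfolding g t_def by (simp add: div_mult_swap)
    show "totient (2 * k) = totient (2 * t) * q" using k t q by (simp add: totient_double)
  qed (use k0 in simp)
  ultimately show ?thesis using moebius_prime_mult[of 2 t] t by simp
qed

text \<open>Primes are attached to \<open>g\<close> one at a time; since each already divides
  \<open>t\<close>, it multiplies the totient by \<open>p\<close> rather than
  \<open>p - 1\<close>.\<close>

lemma totient_mult_same_primes:
  fixes t g :: nat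
  assumes "\<And>p. prime p \<Longrightarrow> p dvd g \<Longrightarrow> p dvd t"
  shows "totient (t * g) = totient t * g"
  using assms
proof (induction g rule: prime_divisors_induct)
  case (factor p g)
  have "p dvd t" using factor by simp
  hence "gcd p (t * g) = p" by (simp add: gcd_nat.absorb1)
  moreover have "totient p > 0" using factor by (simp add: prime_gt_0_nat)
  ultimately have "totient (p * (t * g)) = totient (t * g) * p"
    by (simp add: totient_mult[of p])
  thus ?case using factor by (simp add: mult_ac)
qed auto

text \<open>Here c(j, m) = \<open>moebius t * q\<close> with q = totient m / totient t. Oddness
  needs both factors odd, and a prime of the odd \<open>m\<close> missing from \<open>t\<close>
  would put the even number \<open>p - 1\<close> into \<open>q\<close>.\<close>

lemma odd_ramanujan_cD:
  fixes m j :: nat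
  assumes m: "odd m" and c: "odd (ramanujan_c j m)"
  shows "squarefree (m div gcd m j)"
    and "\<And>p. prime p \<Longrightarrow> p dvd m \<Longrightarrow> p dvd m div gcd m j"
proof -
  define t where "t = m div gcd m j"
  have m0: "m > 0" using m by (simp add: odd_pos)
  obtain g where g: "m = t * g" by (metis t_def dvd_div_mult_self gcd_dvd1)
  have t: "t > 0" using g m0 by (auto intro: gr0I)
  obtain q where q: "totient m = totient t * q" using totient_dvd[of t m] g by auto
  have eq: "ramanujan_c j m = moebius t * int q" by (rule ramanujan_c_eq[OF m0 t_def q])
  show "squarefree (m div gcd m j)"
    using c by (simp add: eq odd_moebius_iff t_def)
  fix p assume p: "prime p" "p dvd m"
  have "p dvd t"
  proof (rule ccontr)
    assume n: "\<not> p dvd t"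
    hence "p dvd g" using p g by (simp add: prime_dvd_mult_iff)
    hence "totient (t * p) dvd totient m" unfolding g by (intro totient_dvd mult_dvd_mono) auto
    moreover have "totient (t * p) = totient t * (p - 1)"
      using n p by (simp add: totient_mult_coprime coprime_commute prime_imp_coprime totient_prime)
    ultimately have "p - 1 dvd q" using q t by simp
    moreover have "odd p" using p m by auto
    ultimately have "even q" by (metis dvd_trans odd_even_add even_diff_nat dvd_def odd_one)
    thus False using c by (simp add: eq)
  qed
  thus "p dvd m div gcd m j" by (simp add: t_def)
qed

section \<open>Construction of an index isolating one odd part\<close>

lemma coprime_part_decomposition:
  fixes n m :: nat
  assumes "n > 0"
  obtains A N where "n = A * N" "coprime N m" "\<And>p. prime p \<Longrightarrow> p dvd A \<Longrightarrow> p dvd m"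
  using assms
proof (induction n arbitrary: thesis rule: less_induct)
  case (less n)
  show ?case
  proof (cases "coprime n m")
    case True
    show ?thesis by (rule less.prems(1)[of 1 n]) (use True in auto)
  next
    case False
    then obtain p where p: "prime p" "p dvd n" "p dvd m"
      by (metis coprime_iff_gcd_eq_1 gcd_dvd1 gcd_dvd2 dvd_trans prime_factor_nat)
    then obtain n' where n': "n = p * n'" by blast
    have "n' < n" "n' > 0" using n' less.prems(2) prime_gt_1_nat[OF p(1)] by auto
    then obtain A N where AN: "n' = A * N" "coprime N m"
      "\<And>q. prime q \<Longrightarrow> q dvd A \<Longrightarrow> q dvd m"
      using less.IH by blast
    show ?thesis
    proof (rule less.prems(1)[of "p * A" N])
      fix q assume "prime q" "q dvd p * A"
      thus "q dvd m" using p AN by (metis prime_dvd_mult_iff primes_dvd_imp_eq)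
    qed (use n' AN in auto)
  qed
qed

lemma squarefree_prod_primes:
  assumes "finite P" "\<And>p. p \<in> P \<Longrightarrow> prime (p :: nat)"
  shows "squarefree (\<Prod>P)"
  by (rule squarefree_prod_coprime) (use assms in \<open>auto intro: primes_coprime squarefree_prime\<close>)

lemma squarefree_dvd_prod_prime_factors:
  fixes t m :: nat
  assumes t: "squarefree t" and m: "m > 0" and p: "\<And>p. prime p \<Longrightarrow> p dvd t \<Longrightarrow> p dvd m"
  shows "t dvd \<Prod>(prime_factors m)"
proof -
  have t0: "t \<noteq> 0" using t by (metis not_squarefree_0)
  have "t = (\<Prod>p\<in>prime_factors t. p ^ multiplicity p t)"
    using prod_prime_factors[OF t0] by simp
  also have "\<dots> = \<Prod>(prime_factors t)"
  proof (rule prod.cong)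
    fix p assume p: "p \<in> prime_factors t"
    hence "multiplicity p t \<le> 1" using t t0 by (auto simp: squarefree_factorial_semiring'')
    moreover have "multiplicity p t > 0" using p by (simp add: prime_factors_multiplicity)
    ultimately have "multiplicity p t = 1" by simp
    thus "p ^ multiplicity p t = p" by simp
  qed simp
  also have "\<dots> dvd \<Prod>(prime_factors m)"
    by (rule prod_dvd_prod_subset) (use p m in \<open>auto simp: prime_factors_dvd\<close>)
  finally show ?thesis .
qed

text \<open>The index is \<open>s * N\<close> with \<open>s\<close> = m / rad m. The last hypothesis
  excludes m = 1 with \<open>n\<close> odd, where \<open>s * N\<close> would be \<open>n\<close>
  itself and out of range.\<close>

lemma ex_isolating_index:
  fixes n m :: nat
  assumes m: "odd m" and mn: "m dvd n" and n: "n \<ge> 2" and mn': "m \<noteq> 1 \<or> even n"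
  obtains j where "odd j" "j \<le> n - 1" "odd (ramanujan_c j m)"
    and "\<And>k. odd k \<Longrightarrow> k dvd n \<Longrightarrow> odd (ramanujan_c j k) \<Longrightarrow> k dvd m"
proof -
  have m0: "m > 0" using m by (simp add: odd_pos)
  have n0: "n > 0" using n by simp
  \<comment> \<open>The factor 2 makes \<open>N\<close>, and with it \<open>j\<close>, odd.\<close>
  obtain A N where AN: "n = A * N" "coprime N (2 * m)"
    "\<And>p. prime p \<Longrightarrow> p dvd A \<Longrightarrow> p dvd 2 * m"
    using coprime_part_decomposition[OF n0] by metis
  define r where "r = \<Prod>(prime_factors m)"
  have sq: "squarefree r" unfolding r_def by (rule squarefree_prod_primes) auto
  have rm: "r dvd m"
  proof -
    have "r dvd (\<Prod>p\<in>prime_factors m. p ^ multiplicity p m)" unfolding r_def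
      by (rule prod_dvd_prod) (auto simp: prime_factors_multiplicity intro: dvd_power)
    thus ?thesis using prod_prime_factors[of m] m0 by simp
  qed
  then obtain s where s: "m = r * s" by blast
  have r0: "r > 0" and s0: "s > 0" using s m0 by auto
  have N: "coprime N m" "odd N" using AN(2) by (auto simp: coprime_commute)
  have pr: "p dvd r" if "prime p" "p dvd m" for p
    unfolding r_def using that m0 by (auto intro!: dvd_prodI simp: prime_factors_dvd)
  define j where "j = s * N"
  have odd_s: "odd s" using s m by auto
  have oj: "odd j" using odd_s N by (simp add: j_def)
  have mA: "m dvd A" using mn AN(1) N(1) by (simp add: coprime_dvd_mult_left_iff coprime_commute)
  have rj: "r * j dvd n" unfolding AN(1) j_def using mA s by (simp add: mult.assoc[symmetric])
  \<comment> \<open>As \<open>r * j\<close> divides \<open>n\<close>, equality forces rad m = 1, so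
    m = 1, while n = j is odd.\<close>
  have "j \<noteq> n"
  proof
    assume jn: "j = n"
    hence "r = 1" using rj n0 by (metis dvd_mult_cancel2 nat_dvd_1_iff_1 mult.commute)
    hence "\<not> prime p \<or> \<not> p dvd m" for p using pr by (metis not_prime_unit)
    hence "m = 1" using prime_factor_nat by blast
    thus False using jn oj mn' by simp
  qed
  moreover have "j \<le> n" using rj n0 by (meson dvd_imp_le dvd_mult_right)
  ultimately have jle: "j \<le> n - 1" by simp
  have g: "gcd m j = s"
  proof -
    have "coprime r N" using N(1) s by (simp add: coprime_commute)
    thus ?thesis unfolding j_def s by (metis coprime_imp_gcd_eq_1 gcd_mult_distrib_nat mult.commute mult.right_neutral)
  qed
  have "ramanujan_c j m = moebius r * int s"
  proof (rule ramanujan_c_eq[OF m0])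
    show "r = m div gcd m j" using g s s0 by simp
    show "totient m = totient r * s" unfolding s
      by (rule totient_mult_same_primes) (use pr s in auto)
  qed
  hence "odd (ramanujan_c j m)" using sq odd_s by (simp add: odd_moebius_iff)
  moreover have "k dvd m" if k: "odd k" "k dvd n" "odd (ramanujan_c j k)" for k
  proof -
    define t where "t = k div gcd k j"
    have t: "squarefree t" "\<And>p. prime p \<Longrightarrow> p dvd k \<Longrightarrow> p dvd t"
      using odd_ramanujan_cD[OF k(1,3)] by (auto simp: t_def)
    have kt: "k = t * gcd k j" by (simp add: t_def)
    have "k > 0" using k by (simp add: odd_pos)
    \<comment> \<open>The part \<open>b\<close> of \<open>k\<close> inside \<open>N\<close> divides
      \<open>j\<close>, so the gcd absorbs it. This leaves \<open>t\<close> dividing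
      \<open>A\<close>, whose primes divide \<open>2 * m\<close>; as \<open>k\<close> is odd, the
      primes of \<open>t\<close> divide \<open>m\<close>.\<close>
    obtain a b where ab: "k = a * b" "a dvd A" "b dvd N"
      using k(2) AN(1) division_decomp by blast
    have "b dvd gcd k j" using ab by (simp add: j_def)
    then obtain e where e: "gcd k j = b * e" by blast
    have "a * b = t * e * b" using kt unfolding e by (simp add: ab(1) mult_ac)
    moreover have "b \<noteq> 0" using ab \<open>k > 0\<close> by auto
    ultimately have "a = t * e" by (metis mult_right_cancel)
    hence tA: "t dvd A" using ab(2) by auto
    have p_t: "p dvd m" if p: "prime p" "p dvd t" for p
    proof -
      have "p dvd 2 * m" using AN(3) p tA by (blast intro: dvd_trans)
      moreover have "p \<noteq> 2" using p kt k(1) by (metis dvd_mult2)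
      ultimately show ?thesis using p(1) by (metis prime_dvd_mult_iff primes_dvd_imp_eq two_is_prime_nat)
    qed
    have "t dvd r" unfolding r_def by (rule squarefree_dvd_prod_prime_factors[OF t(1) m0 p_t])
    \<comment> \<open>Both factors of k = t * gcd(k, j) are bounded: \<open>t\<close> by
      \<open>r\<close> and the gcd by \<open>j\<close>. Since r * j = m * N, it remains to remove
      \<open>N\<close>, which shares no prime with \<open>k\<close>.\<close>
    hence "k dvd r * j" by (subst kt) (rule mult_dvd_mono, auto)
    hence "k dvd m * N" by (simp add: s j_def mult_ac)
    moreover have "coprime k N"
    proof (rule ccontr)
      assume "\<not> coprime k N"
      then obtain p where p: "prime p" "p dvd k" "p dvd N"
        by (metis coprime_iff_gcd_eq_1 gcd_dvd1 gcd_dvd2 dvd_trans prime_factor_nat)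
      hence "p dvd m" using t p_t by blast
      thus False using N(1) p by (metis coprime_common_divisor not_prime_unit)
    qed
    ultimately show ?thesis by (simp add: coprime_dvd_mult_left_iff)
  qed
  ultimately show ?thesis using that oj jle by blast
qed

section \<open>Cancellation of the pairs d, 2d\<close>

text \<open>The conjunct \<open>even d\<close> is needed for d/2 to be meant literally, since
  \<open>div\<close> rounds down for odd \<open>d\<close>.\<close>

definition unpaired :: "nat set \<Rightarrow> nat set" where
  "unpaired D = {d \<in> D. \<not> (even d \<and> d div 2 \<in> D) \<and> 2 * d \<notin> D}"

text \<open>Swapping \<open>d\<close> and \<open>2 * d\<close> is a sign-reversing involution on the
  paired divisors, so their sum equals its own negative.\<close>

lemma icg_eigenvalue_unpaired:
  assumes n: "n \<ge> 2" and D: "D \<subseteq> {d. d dvd n \<and> 1 \<le> d \<and> d < n}"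
    and nd4: "\<forall>d\<in>D. \<not> 4 dvd n div d" and j: "odd j"
  shows "icg_eigenvalue n D j = (\<Sum>d\<in>unpaired D. ramanujan_c j (n div d))"
proof -
  let ?f = "\<lambda>d. ramanujan_c j (n div d)"
  have finD: "finite D" by (rule finite_subset[OF D]) (use n in auto)
  \<comment> \<open>No chain d, 2d, 4d occurs in \<open>D\<close>, so partners are unique and
    \<sigma> is an involution.\<close>
  have n4: "4 * d \<notin> D" if "d \<in> D" for d
  proof
    assume "4 * d \<in> D"
    then obtain k where "n = 4 * d * k" using D by (auto elim: dvdE)
    moreover have "d > 0" using that D by auto
    ultimately have "n div d = 4 * k" by simp
    thus False using nd4 that by auto
  qed
  have neg: "?f d = - ?f (2 * d)" if d: "d \<in> D" "2 * d \<in> D" for d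
  proof -
    obtain k where k: "n = 2 * d * k" using d D by (auto elim: dvdE)
    have "d > 0" using d D by auto
    hence nd: "n div d = 2 * k" "n div (2 * d) = k" using k by simp_all
    have "odd k" using nd4 d nd by auto
    thus ?thesis using ramanujan_c_double[OF j] by (simp add: nd)
  qed
  define \<sigma> where "\<sigma> d = (if 2 * d \<in> D then 2 * d else d div 2)" for d
  let ?P = "D - unpaired D"
  have P: "\<sigma> d \<in> ?P \<and> \<sigma> (\<sigma> d) = d \<and> ?f (\<sigma> d) = - ?f d" if d: "d \<in> ?P" for d
  proof (cases "2 * d \<in> D")
    case True
    thus ?thesis using d n4[of d] neg[of d] by (auto simp: \<sigma>_def unpaired_def)
  next
    case False
    then obtain e where e: "d = 2 * e" "e \<in> D" using d by (auto simp: unpaired_def)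
    thus ?thesis using d False neg[of e] by (auto simp: \<sigma>_def unpaired_def)
  qed
  have "sum ?f ?P = (\<Sum>d\<in>?P. - ?f d)"
    by (rule sum.reindex_bij_witness[of _ \<sigma> \<sigma>]) (use P in auto)
  hence "sum ?f ?P = 0" by (simp add: sum_negf)
  moreover have "sum ?f D = sum ?f ?P + sum ?f (unpaired D)"
    by (rule sum.subset_diff) (use finD in \<open>auto simp: unpaired_def\<close>)
  ultimately show ?thesis by (simp add: icg_eigenvalue_def)
qed

section \<open>Odd parts of the quotients n/d\<close>

text \<open>One halving yields the full odd part as long as 4 does not divide
  \<open>m\<close>.\<close>

definition odd_half :: "nat \<Rightarrow> nat" where
  "odd_half m = (if even m then m div 2 else m)"

lemma odd_half:
  assumes "\<not> 4 dvd m"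
  shows "odd (odd_half m)" and "odd_half m dvd m"
    and "odd j \<Longrightarrow> odd (ramanujan_c j m) \<longleftrightarrow> odd (ramanujan_c j (odd_half m))"
proof -
  show o: "odd (odd_half m)" and "odd_half m dvd m"
    using assms by (auto simp: odd_half_def elim!: evenE)
  assume "odd j"
  thus "odd (ramanujan_c j m) \<longleftrightarrow> odd (ramanujan_c j (odd_half m))"
    using ramanujan_c_double[of j "odd_half m"] o by (cases "even m") (simp_all add: odd_half_def)
qed

text \<open>Quotients with equal \<open>odd_half\<close> agree or differ by a factor 2. In the
  latter case one of \<open>x\<close>, \<open>y\<close> is twice the other, so neither is
  unpaired.\<close>

lemma inj_on_odd_half_unpaired:
  assumes D: "D \<subseteq> {d. d dvd n \<and> 1 \<le> d \<and> d < n}"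
  shows "inj_on (\<lambda>d. odd_half (n div d)) (unpaired D)"
proof (rule inj_onI)
  fix x y assume xy: "x \<in> unpaired D" "y \<in> unpaired D" "odd_half (n div x) = odd_half (n div y)"
  have D': "\<exists>k>0. n = d * k \<and> n div d = k" if "d \<in> unpaired D" for d
    using that D by (fastforce simp: unpaired_def)
  obtain k l where k: "k > 0" "n = x * k" "n div x = k" and l: "l > 0" "n = y * l" "n div y = l"
    using D'[OF xy(1)] D'[OF xy(2)] by blast
  have "k = l \<or> k = 2 * l \<or> l = 2 * k"
    using xy(3) k l by (auto simp: odd_half_def split: if_splits elim!: evenE)
  moreover have "x * k = y * l" using k l by simp
  ultimately have "x = y \<or> y = 2 * x \<or> x = 2 * y" using k(1) l(1) by auto
  thus "x = y" using xy by (auto simp: unpaired_def)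
qed

theorem mainTheorem3:
  fixes n :: nat and D :: "nat set"
  assumes "n \<ge> 2"
    and "D \<subseteq> {d. d dvd n \<and> 1 \<le> d \<and> d < n}"
    and "\<forall>d\<in>D. \<not> 4 dvd n div d"
  shows "(\<exists>j. odd j \<and> j \<le> n - 1 \<and> odd (icg_eigenvalue n D j)) \<longleftrightarrow>
         (\<exists>d\<in>D. \<not> (even d \<and> d div 2 \<in> D) \<and> 2 * d \<notin> D)"
proof -
  have "(\<exists>j. odd j \<and> j \<le> n - 1 \<and> odd (icg_eigenvalue n D j)) \<longleftrightarrow> unpaired D \<noteq> {}"
  proof
    assume "\<exists>j. odd j \<and> j \<le> n - 1 \<and> odd (icg_eigenvalue n D j)"
    \<comment> \<open>Without unpaired divisors the eigenvalue is an empty sum, hence 0 and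
      even.\<close>
    thus "unpaired D \<noteq> {}" using icg_eigenvalue_unpaired[OF assms] by force
  next
    assume ne: "unpaired D \<noteq> {}"
    have UD: "unpaired D \<subseteq> D" by (auto simp: unpaired_def)
    have finU: "finite (unpaired D)"
      by (rule finite_subset[OF UD], rule finite_subset[OF assms(2)]) (use assms(1) in auto)
    let ?o = "\<lambda>d. odd_half (n div d)"
    obtain d where d: "d \<in> unpaired D" and min: "\<And>e. e \<in> unpaired D \<Longrightarrow> ?o d \<le> ?o e"
      using ex_min_if_finite[of "?o ` unpaired D"] finU ne by (auto simp: not_less)
    have dD: "e dvd n" "e < n" "e > 0" "\<not> 4 dvd n div e" if "e \<in> unpaired D" for e
      using that UD assms(2,3) by auto
    have o_dvd: "?o e dvd n" if "e \<in> unpaired D" for e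
      using odd_half(2)[OF dD(4)[OF that]] dD(1)[OF that] by (metis dvd_trans dvd_div_mult_self dvd_triv_left)
    \<comment> \<open>Otherwise n/d is odd with odd part 1, giving d = n, although \<open>D\<close>
      contains only proper divisors.\<close>
    have "?o d \<noteq> 1 \<or> even n"
    proof (rule ccontr)
      assume a: "\<not> (?o d \<noteq> 1 \<or> even n)"
      have nd: "n = d * (n div d)" using dD(1)[OF d] by simp
      hence "odd (n div d)" using a by (metis even_mult_iff)
      hence "n div d = 1" using a by (simp add: odd_half_def)
      thus False using nd dD(2)[OF d] by simp
    qed
    then obtain j where j: "odd j" "j \<le> n - 1" "odd (ramanujan_c j (?o d))"
      and iso: "\<And>k. odd k \<Longrightarrow> k dvd n \<Longrightarrow> odd (ramanujan_c j k) \<Longrightarrow> k dvd ?o d"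
      using ex_isolating_index[OF odd_half(1)[OF dD(4)[OF d]] o_dvd[OF d] assms(1)] by metis
    \<comment> \<open>An odd term at \<open>e\<close> makes \<open>?o e\<close> divide the minimal
      \<open>?o d\<close>; so they are equal, and injectivity gives e = d.\<close>
    have "even (ramanujan_c j (n div e))" if e: "e \<in> unpaired D - {d}" for e
    proof (rule ccontr)
      have eU: "e \<in> unpaired D" using e by simp
      assume "odd (ramanujan_c j (n div e))"
      hence "odd (ramanujan_c j (?o e))" using odd_half(3)[OF dD(4)[OF eU] j(1)] by simp
      hence "?o e dvd ?o d" using iso odd_half(1)[OF dD(4)[OF eU]] o_dvd[OF eU] by blast
      moreover have "?o d > 0" using odd_half(1)[OF dD(4)[OF d]] by (simp add: odd_pos)
      ultimately have "?o e = ?o d" using min[OF eU] by (simp add: dvd_imp_le le_antisym)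
      thus False using inj_on_odd_half_unpaired[OF assms(2)] eU d e by (auto dest: inj_onD)
    qed
    hence "even (\<Sum>e\<in>unpaired D - {d}. ramanujan_c j (n div e))" by (rule dvd_sum)
    moreover have "odd (ramanujan_c j (n div d))" using odd_half(3)[OF dD(4)[OF d] j(1)] j(3) by simp
    ultimately have "odd (icg_eigenvalue n D j)"
      by (simp add: icg_eigenvalue_unpaired[OF assms j(1)] sum.remove[OF finU d])
    thus "\<exists>j. odd j \<and> j \<le> n - 1 \<and> odd (icg_eigenvalue n D j)" using j by blast
  qed
  thus ?thesis by (auto simp: unpaired_def)
qed

end
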